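(* Let $Z_1,\dots,Z_n$ be i.i.d. random matrices in $\mathbb{R}^{d\times d}$ with $\mathbb{E}[Z_1]=0$ and $\mathbb{E}[\|Z_1\|_F^4]<\infty$. Then $$\mathbb{E}\left[\biggl\|\frac1n\sum_{i=1}^nZ_i\biggr\|_F^4\right]\le\frac{3}{n^2}\,\mathbb{E}\left[\|Z_1\|_F^4\right].$$
   Context: $\|\cdot\|_F$ denotes the Frobenius norm. *)

theory Defs
  imports "HOL-Probability.Probability"
begin

definition frobenius_norm :: "real ^ 'n ^ 'm \<Rightarrow> real" where
  "frobenius_norm A = sqrt (\<Sum>i\<in>UNIV. \<Sum>j\<in>UNIV. (A $ i $ j)\<^sup>2)"

lemma frobenius_norm_eq_norm: "frobenius_norm A = norm A"
  by (simp add: frobenius_norm_def norm_vec_def L2_set_def sum_nonneg)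

text \<open>Measurability of each \<open>Z i\<close> is part of \<open>prob_space.indep_vars\<close>. The laws are compared
  with that of \<open>Z 1\<close>, so the notion is meant for \<open>n \<ge> 1\<close>.\<close>

definition iid_matrices ::
    "'a measure \<Rightarrow> nat \<Rightarrow> (nat \<Rightarrow> 'a \<Rightarrow> real ^ 'd ^ 'd) \<Rightarrow> bool" where
  "iid_matrices M n Z \<longleftrightarrow>
     prob_space.indep_vars M (\<lambda>_. borel) Z {1..n} \<and>
     (\<forall>i\<in>{1..n}. distr M borel (Z i) = distr M borel (Z 1))"

end

theory Submission
  imports Defs
begin

text \<open>The Frobenius norm is the Euclidean norm, so this is a fourth-moment bound for sums of
  independent centred vectors \<open>X\<^sub>i\<close> in a Euclidean space. It follows by adding one summand at a
  time. Let \<open>S\<close> be a partial sum and \<open>X\<close> the next summand, independent of \<open>S\<close>. Expanding,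
  \<open>|S + X|^4 = (|S|^2 + 2 S \<bullet> X + |X|^2)^2\<close>. The two terms of odd degree in each vector,
  \<open>4 |S|^2 (S \<bullet> X)\<close> and \<open>4 |X|^2 (S \<bullet> X)\<close>, are inner products of a function of \<open>S\<close> with a
  function of \<open>X\<close>, one of the two being centred, so their expectations vanish. Cauchy--Schwarz,
  \<open>(S \<bullet> X)^2 \<le> |S|^2 |X|^2\<close>, bounds the remaining mixed terms, and hence
  \<open>E |S + X|^4 \<le> E |S|^4 + 6 E |S|^2 E |X|^2 + E |X|^4\<close> (\<open>fourth_moment_add_indep\<close>).

  If every summand has \<open>E |X\<^sub>i|^4 \<le> m\<close>, then \<open>E |X\<^sub>i|^2 \<le> sqrt m\<close>, and orthogonality gives
  \<open>E |S|^2 \<le> k sqrt m\<close> for a sum of \<open>k\<close> terms. Since \<open>3 k^2 m + 6 k m + m \<le> 3 (k + 1)^2 m\<close>,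
  induction yields \<open>E |S|^4 \<le> 3 k^2 m\<close> (\<open>fourth_moment_sum_indep\<close>). Scaling by \<open>1/n\<close> divides this
  by \<open>n^4\<close>.\<close>

section \<open>Lower moments from the fourth moment\<close>

lemma (in prob_space) integrable_norm_power_le_4:
  fixes X :: "'a \<Rightarrow> 'b::{banach, second_countable_topology}"
  assumes [measurable]: "random_variable borel X"
    and "integrable M (\<lambda>\<omega>. norm (X \<omega>) ^ 4)" and "k \<le> 4"
  shows "integrable M (\<lambda>\<omega>. norm (X \<omega>) ^ k)"
proof (rule Bochner_Integration.integrable_bound)
  show "integrable M (\<lambda>\<omega>. 1 + norm (X \<omega>) ^ 4)"
    using assms(2) by simp
  have "t ^ k \<le> 1 + t ^ 4" if "t \<ge> 0" for t :: real
  proof (cases "t \<le> 1")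
    case True
    then show ?thesis using that power_le_one[of t k] by (simp add: add_increasing2)
  next
    case False
    then have "t ^ k \<le> t ^ 4" using \<open>k \<le> 4\<close> by (intro power_increasing) auto
    then show ?thesis by simp
  qed
  then show "AE \<omega> in M. norm (norm (X \<omega>) ^ k) \<le> norm (1 + norm (X \<omega>) ^ 4)"
    by simp
qed simp

lemma (in prob_space) second_moment_le_sqrt_fourth_moment:
  fixes X :: "'a \<Rightarrow> 'b::{banach, second_countable_topology}"
  assumes "random_variable borel X" and "integrable M (\<lambda>\<omega>. norm (X \<omega>) ^ 4)"
  shows "expectation (\<lambda>\<omega>. (norm (X \<omega>))\<^sup>2) \<le> sqrt (expectation (\<lambda>\<omega>. norm (X \<omega>) ^ 4))"
proof -
  have "integrable M (\<lambda>\<omega>. (norm (X \<omega>))\<^sup>2)"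
    using integrable_norm_power_le_4[OF assms] by simp
  then have "variance (\<lambda>\<omega>. (norm (X \<omega>))\<^sup>2)
      = expectation (\<lambda>\<omega>. norm (X \<omega>) ^ 4) - (expectation (\<lambda>\<omega>. (norm (X \<omega>))\<^sup>2))\<^sup>2"
    using assms(2) by (subst variance_eq) (simp_all flip: power_mult)
  with variance_positive[of "\<lambda>\<omega>. (norm (X \<omega>))\<^sup>2"] show ?thesis
    by (intro real_le_rsqrt) simp
qed

section \<open>Independent vectors\<close>

text \<open>In coordinates the inner product is a sum of products of independent real variables.\<close>

lemma (in prob_space) indep_var_inner:
  fixes U V :: "'a \<Rightarrow> 'b::euclidean_space"
  assumes indep: "indep_var borel U borel V" and int: "integrable M U" "integrable M V"
  shows indep_var_integrable_inner: "integrable M (\<lambda>\<omega>. U \<omega> \<bullet> V \<omega>)"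
    and indep_var_expectation_inner:
      "expectation (\<lambda>\<omega>. U \<omega> \<bullet> V \<omega>) = expectation U \<bullet> expectation V"
proof -
  have coord: "indep_var borel (\<lambda>\<omega>. U \<omega> \<bullet> b) borel (\<lambda>\<omega>. V \<omega> \<bullet> b)" for b
    using indep_var_compose[OF indep, of "\<lambda>x. x \<bullet> b" borel "\<lambda>x. x \<bullet> b" borel]
    by (simp add: comp_def)
  have prod_int: "integrable M (\<lambda>\<omega>. (U \<omega> \<bullet> b) * (V \<omega> \<bullet> b))" for b
    using int by (intro indep_var_integrable[OF coord]) auto
  have prod_eq: "expectation (\<lambda>\<omega>. (U \<omega> \<bullet> b) * (V \<omega> \<bullet> b))
      = (expectation U \<bullet> b) * (expectation V \<bullet> b)" for b
    using int by (subst indep_var_lebesgue_integral[OF coord]) auto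
  show "integrable M (\<lambda>\<omega>. U \<omega> \<bullet> V \<omega>)"
    by (subst euclidean_inner) (intro Bochner_Integration.integrable_sum prod_int)
  show "expectation (\<lambda>\<omega>. U \<omega> \<bullet> V \<omega>) = expectation U \<bullet> expectation V"
    by (subst (1 2) euclidean_inner)
      (simp add: Bochner_Integration.integral_sum prod_int prod_eq)
qed

text \<open>The sum and the new summand are functions of disjoint blocks of the family.\<close>

lemma (in prob_space) indep_vars_sum_vector:
  fixes X :: "'i \<Rightarrow> 'a \<Rightarrow> 'b::euclidean_space"
  assumes "finite I" "i \<notin> I" and indep: "indep_vars (\<lambda>_. borel) X (insert i I)"
  shows "indep_var borel (\<lambda>\<omega>. \<Sum>j\<in>I. X j \<omega>) borel (X i)"
proof -
  have "indep_var
      borel ((\<lambda>f. \<Sum>j\<in>I. f j) \<circ> (\<lambda>\<omega>. restrict (\<lambda>j. X j \<omega>) I))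
      borel ((\<lambda>f. f i) \<circ> (\<lambda>\<omega>. restrict (\<lambda>j. X j \<omega>) {i}))"
    using assms(1,2) by (intro indep_var_compose[OF indep_var_restrict[OF indep]]) auto
  then show ?thesis
    by (simp add: comp_def)
qed

lemma (in prob_space) second_moment_add_indep:
  fixes S X :: "'a \<Rightarrow> 'b::euclidean_space"
  assumes indep: "indep_var borel S borel X"
    and "integrable M S" "integrable M X"
    and "integrable M (\<lambda>\<omega>. (norm (S \<omega>))\<^sup>2)" "integrable M (\<lambda>\<omega>. (norm (X \<omega>))\<^sup>2)"
    and "expectation X = 0"
  shows "expectation (\<lambda>\<omega>. (norm (S \<omega> + X \<omega>))\<^sup>2)
    = expectation (\<lambda>\<omega>. (norm (S \<omega>))\<^sup>2) + expectation (\<lambda>\<omega>. (norm (X \<omega>))\<^sup>2)"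
proof -
  have "(norm (S \<omega> + X \<omega>))\<^sup>2 = (norm (S \<omega>))\<^sup>2 + (norm (X \<omega>))\<^sup>2 + 2 * (S \<omega> \<bullet> X \<omega>)" for \<omega>
    by (simp add: power2_norm_eq_inner inner_add inner_commute)
  then show ?thesis
    using assms by (simp add: indep_var_integrable_inner indep_var_expectation_inner)
qed

lemma norm_add_power4_le:
  fixes s x :: "'b::real_inner"
  shows "norm (s + x) ^ 4 \<le> norm s ^ 4 + norm x ^ 4 + 6 * ((norm s)\<^sup>2 * (norm x)\<^sup>2)
    + 4 * (((norm s)\<^sup>2 *\<^sub>R s) \<bullet> x) + 4 * (s \<bullet> ((norm x)\<^sup>2 *\<^sub>R x))"
proof -
  define a b c where "a = (norm s)\<^sup>2" and "b = (norm x)\<^sup>2" and "c = s \<bullet> x"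
  have "c\<^sup>2 \<le> a * b"
    using Cauchy_Schwarz_ineq[of s x] by (simp add: a_def b_def c_def power2_norm_eq_inner)
  have "norm (s + x) ^ 4 = ((norm (s + x))\<^sup>2)\<^sup>2"
    by (simp flip: power_mult)
  also have "(norm (s + x))\<^sup>2 = a + b + 2 * c"
    by (simp add: a_def b_def c_def power2_norm_eq_inner inner_add inner_commute)
  also have "(a + b + 2 * c)\<^sup>2 = a\<^sup>2 + b\<^sup>2 + 2 * (a * b) + 4 * c\<^sup>2 + 4 * (a * c) + 4 * (b * c)"
    by (simp add: power2_eq_square algebra_simps)
  also have "\<dots> \<le> a\<^sup>2 + b\<^sup>2 + 6 * (a * b) + 4 * (a * c) + 4 * (b * c)"
    using \<open>c\<^sup>2 \<le> a * b\<close> by simp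
  finally show ?thesis
    by (simp add: a_def b_def c_def flip: power_mult)
qed

text \<open>Both odd terms of the pointwise bound \<open>norm_add_power4_le\<close> have expectation zero, because
  each pairs a centred vector with an independent one.\<close>

lemma (in prob_space) fourth_moment_add_indep:
  fixes S X :: "'a \<Rightarrow> 'b::euclidean_space"
  assumes indep: "indep_var borel S borel X"
    and S4: "integrable M (\<lambda>\<omega>. norm (S \<omega>) ^ 4)" and X4: "integrable M (\<lambda>\<omega>. norm (X \<omega>) ^ 4)"
    and mean: "expectation S = 0" "expectation X = 0"
  shows "integrable M (\<lambda>\<omega>. norm (S \<omega> + X \<omega>) ^ 4)"
    and "expectation (\<lambda>\<omega>. norm (S \<omega> + X \<omega>) ^ 4)
      \<le> expectation (\<lambda>\<omega>. norm (S \<omega>) ^ 4) + expectation (\<lambda>\<omega>. norm (X \<omega>) ^ 4)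
        + 6 * (expectation (\<lambda>\<omega>. (norm (S \<omega>))\<^sup>2) * expectation (\<lambda>\<omega>. (norm (X \<omega>))\<^sup>2))"
proof -
  have rv [measurable]: "random_variable borel S" "random_variable borel X"
    using indep by (auto dest: indep_var_rv1 indep_var_rv2)
  have vec: "integrable M Y" "integrable M (\<lambda>\<omega>. (norm (Y \<omega>))\<^sup>2 *\<^sub>R Y \<omega>)"
      "integrable M (\<lambda>\<omega>. (norm (Y \<omega>))\<^sup>2)"
    if [measurable]: "random_variable borel Y" and Y4: "integrable M (\<lambda>\<omega>. norm (Y \<omega>) ^ 4)"
    for Y :: "'a \<Rightarrow> 'b"
  proof -
    note int = integrable_norm_power_le_4[OF that]
    show "integrable M Y"
      using int[of 1] by (simp add: integrable_norm_iff)
    have "integrable M (\<lambda>\<omega>. norm ((norm (Y \<omega>))\<^sup>2 *\<^sub>R Y \<omega>))"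
      using int[of 3] by (simp add: power3_eq_cube power2_eq_square)
    then show "integrable M (\<lambda>\<omega>. (norm (Y \<omega>))\<^sup>2 *\<^sub>R Y \<omega>)"
      by (subst (asm) integrable_norm_iff) simp_all
    show "integrable M (\<lambda>\<omega>. (norm (Y \<omega>))\<^sup>2)"
      using int[of 2] by simp
  qed
  note vecS = vec[OF rv(1) S4] and vecX = vec[OF rv(2) X4]
  have indep_S3: "indep_var borel (\<lambda>\<omega>. (norm (S \<omega>))\<^sup>2 *\<^sub>R S \<omega>) borel X"
    using indep_var_compose[OF indep, where ?Y1.0 = "\<lambda>x. (norm x)\<^sup>2 *\<^sub>R x" and ?Y2.0 = "\<lambda>x. x"
        and ?N1.0 = borel and ?N2.0 = borel]
    unfolding comp_def by measurable
  have indep_X3: "indep_var borel S borel (\<lambda>\<omega>. (norm (X \<omega>))\<^sup>2 *\<^sub>R X \<omega>)"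
    using indep_var_compose[OF indep, where ?Y1.0 = "\<lambda>x. x" and ?Y2.0 = "\<lambda>x. (norm x)\<^sup>2 *\<^sub>R x"
        and ?N1.0 = borel and ?N2.0 = borel]
    unfolding comp_def by measurable
  have indep_sq: "indep_var borel (\<lambda>\<omega>. (norm (S \<omega>))\<^sup>2) borel (\<lambda>\<omega>. (norm (X \<omega>))\<^sup>2)"
    using indep_var_compose[OF indep, where ?Y1.0 = "\<lambda>x. (norm x)\<^sup>2" and ?Y2.0 = "\<lambda>x. (norm x)\<^sup>2"
        and ?N1.0 = borel and ?N2.0 = borel]
    unfolding comp_def by measurable
  note terms_int = S4 X4 indep_var_integrable[OF indep_sq vecS(3) vecX(3)]
    indep_var_integrable_inner[OF indep_S3 vecS(2) vecX(1)]
    indep_var_integrable_inner[OF indep_X3 vecS(1) vecX(2)]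
  define R where "R \<omega> = norm (S \<omega>) ^ 4 + norm (X \<omega>) ^ 4 + 6 * ((norm (S \<omega>))\<^sup>2 * (norm (X \<omega>))\<^sup>2)
    + 4 * (((norm (S \<omega>))\<^sup>2 *\<^sub>R S \<omega>) \<bullet> X \<omega>) + 4 * (S \<omega> \<bullet> ((norm (X \<omega>))\<^sup>2 *\<^sub>R X \<omega>))" for \<omega>
  have le_R: "norm (S \<omega> + X \<omega>) ^ 4 \<le> R \<omega>" for \<omega>
    unfolding R_def by (rule norm_add_power4_le)
  have int_R: "integrable M R"
    unfolding R_def by (intro Bochner_Integration.integrable_add integrable_mult_right terms_int)
  have mono: "AE \<omega> in M. norm (norm (S \<omega> + X \<omega>) ^ 4) \<le> norm (R \<omega>)"
    by (rule AE_I2) (use le_R in \<open>simp add: order_trans[OF _ abs_ge_self]\<close>)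
  show int_sum: "integrable M (\<lambda>\<omega>. norm (S \<omega> + X \<omega>) ^ 4)"
    by (rule Bochner_Integration.integrable_bound[OF int_R _ mono]) simp
  have zero_S3: "expectation (\<lambda>\<omega>. ((norm (S \<omega>))\<^sup>2 *\<^sub>R S \<omega>) \<bullet> X \<omega>) = 0"
    using indep_var_expectation_inner[OF indep_S3 vecS(2) vecX(1)] mean(2) by simp
  have zero_X3: "expectation (\<lambda>\<omega>. S \<omega> \<bullet> ((norm (X \<omega>))\<^sup>2 *\<^sub>R X \<omega>)) = 0"
    using indep_var_expectation_inner[OF indep_X3 vecS(1) vecX(2)] mean(1) by simp
  have "expectation R = expectation (\<lambda>\<omega>. norm (S \<omega>) ^ 4) + expectation (\<lambda>\<omega>. norm (X \<omega>) ^ 4)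
      + 6 * expectation (\<lambda>\<omega>. (norm (S \<omega>))\<^sup>2 * (norm (X \<omega>))\<^sup>2)
      + 4 * expectation (\<lambda>\<omega>. ((norm (S \<omega>))\<^sup>2 *\<^sub>R S \<omega>) \<bullet> X \<omega>)
      + 4 * expectation (\<lambda>\<omega>. S \<omega> \<bullet> ((norm (X \<omega>))\<^sup>2 *\<^sub>R X \<omega>))"
    unfolding R_def using terms_int
    by (simp del: inner_scaleR_left inner_scaleR_right)
  also have "\<dots> = expectation (\<lambda>\<omega>. norm (S \<omega>) ^ 4) + expectation (\<lambda>\<omega>. norm (X \<omega>) ^ 4)
      + 6 * (expectation (\<lambda>\<omega>. (norm (S \<omega>))\<^sup>2) * expectation (\<lambda>\<omega>. (norm (X \<omega>))\<^sup>2))"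
    unfolding zero_S3 zero_X3 indep_var_lebesgue_integral[OF indep_sq vecS(3) vecX(3)] by simp
  finally show "expectation (\<lambda>\<omega>. norm (S \<omega> + X \<omega>) ^ 4)
      \<le> expectation (\<lambda>\<omega>. norm (S \<omega>) ^ 4) + expectation (\<lambda>\<omega>. norm (X \<omega>) ^ 4)
        + 6 * (expectation (\<lambda>\<omega>. (norm (S \<omega>))\<^sup>2) * expectation (\<lambda>\<omega>. (norm (X \<omega>))\<^sup>2))"
    using integral_mono[OF int_sum int_R le_R] by simp
qed

section \<open>Sums of independent centred vectors\<close>

text \<open>The second moment is part of the induction because each step of the fourth-moment estimate
  consumes it.\<close>

lemma (in prob_space) fourth_moment_sum_indep:
  fixes X :: "'i \<Rightarrow> 'a \<Rightarrow> 'b::euclidean_space"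
  assumes "finite I" and "indep_vars (\<lambda>_. borel) X I"
    and "\<And>i. i \<in> I \<Longrightarrow> expectation (X i) = 0"
    and "\<And>i. i \<in> I \<Longrightarrow> integrable M (\<lambda>\<omega>. norm (X i \<omega>) ^ 4)"
    and "\<And>i. i \<in> I \<Longrightarrow> expectation (\<lambda>\<omega>. norm (X i \<omega>) ^ 4) \<le> m"
  shows "integrable M (\<lambda>\<omega>. norm (\<Sum>i\<in>I. X i \<omega>) ^ 4)
    \<and> expectation (\<lambda>\<omega>. (norm (\<Sum>i\<in>I. X i \<omega>))\<^sup>2) \<le> real (card I) * sqrt m
    \<and> expectation (\<lambda>\<omega>. norm (\<Sum>i\<in>I. X i \<omega>) ^ 4) \<le> 3 * (real (card I))\<^sup>2 * m"
  using assms
proof (induction I rule: finite_induct)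
  case empty
  then show ?case by simp
next
  case (insert i I)
  define S where "S \<omega> = (\<Sum>j\<in>I. X j \<omega>)" for \<omega>
  define k where "k = real (card I)"
  have rv: "random_variable borel (X j)" if "j \<in> insert i I" for j
    using insert.prems(1) that by (auto simp: indep_vars_def)
  have int: "integrable M (X j)" "integrable M (\<lambda>\<omega>. (norm (X j \<omega>))\<^sup>2)" if "j \<in> insert i I" for j
    using integrable_norm_power_le_4[OF rv[OF that] insert.prems(3)[OF that], of 1]
      integrable_norm_power_le_4[OF rv[OF that] insert.prems(3)[OF that], of 2] rv[OF that]
    by (auto simp: integrable_norm_iff)
  have "integrable M (\<lambda>\<omega>. norm (S \<omega>) ^ 4)
      \<and> expectation (\<lambda>\<omega>. (norm (S \<omega>))\<^sup>2) \<le> k * sqrt m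
      \<and> expectation (\<lambda>\<omega>. norm (S \<omega>) ^ 4) \<le> 3 * k\<^sup>2 * m"
    unfolding S_def k_def using insert.prems
    by (intro insert.IH indep_vars_subset[OF insert.prems(1)]) auto
  then have S4: "integrable M (\<lambda>\<omega>. norm (S \<omega>) ^ 4)"
    and S2_le: "expectation (\<lambda>\<omega>. (norm (S \<omega>))\<^sup>2) \<le> k * sqrt m"
    and S4_le: "expectation (\<lambda>\<omega>. norm (S \<omega>) ^ 4) \<le> 3 * k\<^sup>2 * m"
    by auto
  have X4: "integrable M (\<lambda>\<omega>. norm (X i \<omega>) ^ 4)"
    and X4_le: "expectation (\<lambda>\<omega>. norm (X i \<omega>) ^ 4) \<le> m"
    using insert.prems by auto
  have X2_le: "expectation (\<lambda>\<omega>. (norm (X i \<omega>))\<^sup>2) \<le> sqrt m"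
    using second_moment_le_sqrt_fourth_moment[OF rv X4] X4_le
    by (meson insertI1 order_trans real_sqrt_le_mono)
  have "m \<ge> 0"
    using X4_le by (rule order_trans[rotated]) simp
  have indep: "indep_var borel S borel (X i)"
    unfolding S_def using insert.hyps insert.prems(1) by (rule indep_vars_sum_vector)
  have int_S: "integrable M S"
    unfolding S_def using int by (intro Bochner_Integration.integrable_sum) auto
  have mean_S: "expectation S = 0"
    unfolding S_def using int insert.prems(2) by (subst Bochner_Integration.integral_sum) auto
  have mean_X: "expectation (X i) = 0"
    using insert.prems(2) by simp
  have int_S2: "integrable M (\<lambda>\<omega>. (norm (S \<omega>))\<^sup>2)"
    using integrable_norm_power_le_4[OF _ S4, of 2] indep_var_rv1[OF indep] by simp
  have "expectation (\<lambda>\<omega>. (norm (S \<omega> + X i \<omega>))\<^sup>2) \<le> (k + 1) * sqrt m"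
    using second_moment_add_indep[OF indep int_S int(1) int_S2 int(2) mean_X] S2_le X2_le
    by (simp add: algebra_simps)
  moreover have "expectation (\<lambda>\<omega>. norm (S \<omega> + X i \<omega>) ^ 4) \<le> 3 * (k + 1)\<^sup>2 * m"
  proof -
    have "expectation (\<lambda>\<omega>. (norm (S \<omega>))\<^sup>2) * expectation (\<lambda>\<omega>. (norm (X i \<omega>))\<^sup>2)
        \<le> (k * sqrt m) * sqrt m"
      using S2_le X2_le \<open>m \<ge> 0\<close> by (intro mult_mono) (auto simp: k_def)
    also have "\<dots> = k * m"
      using \<open>m \<ge> 0\<close> by simp
    finally have "expectation (\<lambda>\<omega>. norm (S \<omega> + X i \<omega>) ^ 4) \<le> 3 * k\<^sup>2 * m + m + 6 * (k * m)"
      using fourth_moment_add_indep(2)[OF indep S4 X4 mean_S mean_X] S4_le X4_le by simp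
    also have "\<dots> \<le> 3 * (k + 1)\<^sup>2 * m"
      using \<open>m \<ge> 0\<close> by (simp add: power2_eq_square algebra_simps)
    finally show ?thesis .
  qed
  moreover have "(\<Sum>j\<in>insert i I. X j \<omega>) = S \<omega> + X i \<omega>" for \<omega>
    using insert.hyps by (simp add: S_def add.commute)
  moreover have "real (card (insert i I)) = k + 1"
    using insert.hyps by (simp add: k_def)
  ultimately show ?case
    using fourth_moment_add_indep(1)[OF indep S4 X4 mean_S mean_X] by simp
qed

theorem lemma2p2:
  fixes M :: "'a measure" and n :: nat and Z :: "nat \<Rightarrow> 'a \<Rightarrow> real ^ 'd ^ 'd"
  assumes "prob_space M"
    and "n \<ge> 1"
    and "iid_matrices M n Z"
    and "(\<integral>\<omega>. Z 1 \<omega> \<partial>M) = 0"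
    and "integrable M (\<lambda>\<omega>. frobenius_norm (Z 1 \<omega>) ^ 4)"
  shows "integrable M (\<lambda>\<omega>. frobenius_norm ((1 / real n) *\<^sub>R (\<Sum>i=1..n. Z i \<omega>)) ^ 4) \<and>
    (\<integral>\<omega>. frobenius_norm ((1 / real n) *\<^sub>R (\<Sum>i=1..n. Z i \<omega>)) ^ 4 \<partial>M)
      \<le> 3 / (real n)\<^sup>2 * (\<integral>\<omega>. frobenius_norm (Z 1 \<omega>) ^ 4 \<partial>M)"
proof -
  interpret prob_space M by fact
  define m where "m = expectation (\<lambda>\<omega>. norm (Z 1 \<omega>) ^ 4)"
  have indep: "indep_vars (\<lambda>_. borel) Z {1..n}"
    and law: "\<And>i. i \<in> {1..n} \<Longrightarrow> distr M borel (Z i) = distr M borel (Z 1)"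
    using assms(3) unfolding iid_matrices_def by - (elim conjE, assumption, elim conjE bspec)
  have rv: "random_variable borel (Z i)" if "i \<in> {1..n}" for i
    using indep that by (auto simp: indep_vars_def)
  have rv1: "random_variable borel (Z 1)"
    using rv \<open>n \<ge> 1\<close> by simp
  \<comment> \<open>Moments depend only on the law, so those of \<open>Z 1\<close> are shared by every \<open>Z i\<close>.\<close>
  have mean: "expectation (Z i) = 0" if "i \<in> {1..n}" for i
    using integral_distr[OF rv[OF that], of "\<lambda>x. x"] integral_distr[OF rv1, of "\<lambda>x. x"]
      law[OF that] assms(4) by simp
  have int4: "integrable M (\<lambda>\<omega>. norm (Z i \<omega>) ^ 4)" if "i \<in> {1..n}" for i
    using integrable_distr_eq[OF rv[OF that], of "\<lambda>x. norm x ^ 4"]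
      integrable_distr_eq[OF rv1, of "\<lambda>x. norm x ^ 4"]
      law[OF that] assms(5) by (simp add: frobenius_norm_eq_norm)
  have moment4: "expectation (\<lambda>\<omega>. norm (Z i \<omega>) ^ 4) = m" if "i \<in> {1..n}" for i
    using integral_distr[OF rv[OF that], of "\<lambda>x. norm x ^ 4"]
      integral_distr[OF rv1, of "\<lambda>x. norm x ^ 4"] law[OF that] by (simp add: m_def)
  have sum: "integrable M (\<lambda>\<omega>. norm (\<Sum>i=1..n. Z i \<omega>) ^ 4)"
      "expectation (\<lambda>\<omega>. norm (\<Sum>i=1..n. Z i \<omega>) ^ 4) \<le> 3 * (real n)\<^sup>2 * m"
    using fourth_moment_sum_indep[OF _ indep mean int4, of m] moment4 by auto
  have scale: "frobenius_norm ((1 / real n) *\<^sub>R (\<Sum>i=1..n. Z i \<omega>)) ^ 4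
      = (1 / real n) ^ 4 * norm (\<Sum>i=1..n. Z i \<omega>) ^ 4" for \<omega>
    by (simp add: frobenius_norm_eq_norm power_mult_distrib power_divide)
  have "(1 / real n) ^ 4 * expectation (\<lambda>\<omega>. norm (\<Sum>i=1..n. Z i \<omega>) ^ 4)
      \<le> (1 / real n) ^ 4 * (3 * (real n)\<^sup>2 * m)"
    by (intro mult_left_mono sum(2)) simp
  also have "\<dots> = 3 / (real n)\<^sup>2 * m"
    using \<open>n \<ge> 1\<close> by (simp add: field_simps power_divide eval_nat_numeral)
  finally show ?thesis
    unfolding scale using sum(1) by (simp add: m_def frobenius_norm_eq_norm)
qed

end
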